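(* Suppose the nonlinear vector Riemannian conjugate gradient method described in the context generates infinite sequences $(x_k),(d_k),(t_k)$. Suppose that: (i) there exists a constant $L>0$ such that for all $x\in\mathcal M$, all $d\in T_x\mathcal M$ with $\|d\|=1$ and all $t\ge 0$, $\|\mathrm D(F\circ R_x)(td)[d]-\mathrm D(F\circ R_x)(0)[d]\|\le Lt$; (ii) with $\mathcal L=\{x\in\mathcal M\mid F(x)\preceq_K F(x_0)\}$, whenever $(G_k)_{k\in\mathbb N}\subset F(\mathcal L)$ satisfies $G_{k+1}\preceq_K G_k$ for all $k$, there exists $\mathcal G\in\mathbb R^m$ with $\mathcal G\preceq_K G_k$ for all $k$; (iii) the level set $\mathcal L$ is bounded; (iv) $\sum_{k\ge 0}\frac{1}{\|d_k\|^2}=\infty$. If, for all $k\ge 1$, $0\le\beta_k\le\beta_k^{\mathrm{CD}}$, where $$\beta_k^{\mathrm{CD}}=\frac{\psi_{x_k,v_k}(0)}{\psi_{x_{k-1},d_{k-1}}(0)},$$ and, for all $k\ge 0$, $t_k$ satisfies the strong Wolfe conditions $$F(R_{x_k}(t_kd_k))\preceq_K F(x_k)+c_1t_k\,\varphi(\mathrm DF(x_k)[d_k])\,e,\qquad |\psi_{x_k,d_k}(t_kd_k)|\le c_2\,|\psi_{x_k,d_k}(0)|,$$ then $\liminf_{k\to\infty}\|v(x_k)\|=0$.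
   Context: $K\subset\mathbb R^m$ is a closed, convex, pointed ($K\cap(-K)=\{0\}$) cone with nonempty interior; $u\preceq_K v$ means $v-u\in K$. $K^*=\{\omega\in\mathbb R^m\mid \omega^Ty\ge 0\ \text{for all } y\in K\}$, and $C\subset K^*\setminus\{0\}$ is a compact set such that $K^*$ is the cone generated by the convex hull of $C$. $\varphi:\mathbb R^m\to\mathbb R$ is $\varphi(y)=\sup\{y^Tw\mid w\in C\}$. $e\in K$ is a fixed vector with $0<\langle\omega,e\rangle\le 1$ for all $\omega\in C$, and $0<c_1<c_2<1$ are fixed constants. $\mathcal M$ is an $n$-dimensional smooth Riemannian manifold; $\|\cdot\|$ is the norm induced by the metric on tangent spaces (and the Euclidean norm on $\mathbb R^m$). $F:\mathcal M\to\mathbb R^m$ is continuously differentiable with derivative $\mathrm DF(x):T_x\mathcal M\to\mathbb R^m$. $R:T\mathcal M\to\mathcal M$ is a retraction, i.e. a smooth map whose restrictions $R_x$ to $T_x\mathcal M$ satisfy $R_x(0_x)=x$ and $\mathrm DR_x(0_x)=\mathrm{id}_{T_x\mathcal M}$. For $x\in\mathcal M$, $v(x)$ is the unique minimizer over $d\in T_x\mathcal M$ of $\varphi(\mathrm DF(x)[d])+\|d\|^2/2$; $v_k:=v(x_k)$. For $x\in\mathcal M$, $d\in T_x\mathcal M$, $t\ge 0$, put $\psi_{x,d}(td):=\varphi\big(\mathrm DF(R_x(td))[\mathrm DR_x(td)[d]]\big)$, so $\psi_{x,d}(0)=\varphi(\mathrm DF(x)[d])$. The nonlinear vector Riemannian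 conjugate gradient method: start from $x_0\in\mathcal M$; at iteration $k$ stop if $v(x_k)=0$; otherwise set $d_0=v(x_0)$ and, for $k\ge 1$, $d_k=v(x_k)+\beta_k\mathcal T^{k-1}(d_{k-1})$, where $\beta_k\in\mathbb R$ is an algorithmic parameter and $\mathcal T^{k-1}(d_{k-1}):=\mathrm DR_{x_{k-1}}(t_{k-1}d_{k-1})[d_{k-1}]\in T_{x_k}\mathcal M$; choose a step size $t_k>0$ and set $x_{k+1}=R_{x_k}(t_kd_k)$. In particular, if infinite sequences are generated then $v(x_k)\ne 0$ for all $k$. *)

theory Defs
  imports "HOL-Analysis.Analysis"
begin

section \<open>Smooth manifolds given by an atlas\<close>

text \<open>Functions of class \<open>C\<^sup>k\<close> on an open subset of a Euclidean space (openness is part of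
  the notion, so that \<^const>\<open>frechet_derivative\<close> is the total derivative).\<close>

primrec Ck_on :: "nat \<Rightarrow> 'a::euclidean_space set \<Rightarrow> ('a \<Rightarrow> 'b::real_normed_vector) \<Rightarrow> bool" where
  "Ck_on 0 S f \<longleftrightarrow> open S \<and> continuous_on S f"
| "Ck_on (Suc k) S f \<longleftrightarrow> open S \<and> (\<forall>x\<in>S. f differentiable (at x)) \<and>
     (\<forall>v. Ck_on k S (\<lambda>x. frechet_derivative f (at x) v))"

text \<open>A chart is a pair of its domain and its coordinate map; values of the coordinate map outside
  the domain are irrelevant.\<close>

type_synonym ('p, 'e) chart = "'p set \<times> ('p \<Rightarrow> 'e)"

text \<open>A map is of class \<open>C\<^sup>k\<close> between the manifolds with atlases \<open>A\<close> and \<open>B\<close> if all its coordinate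
  expressions are \<open>C\<^sup>k\<close> on their natural domains and these domains are open. The openness
  makes the map continuous for the manifold topologies, so the topologies need not be mentioned.\<close>

definition Ck_map ::
  "nat \<Rightarrow> ('p, 'e::euclidean_space) chart set \<Rightarrow> ('q, 'f::euclidean_space) chart set \<Rightarrow> ('p \<Rightarrow> 'q) \<Rightarrow> bool"
where
  "Ck_map k A B f \<longleftrightarrow> (\<forall>(U, \<phi>)\<in>A. \<forall>(V, \<psi>)\<in>B.
     Ck_on k (\<phi> ` (U \<inter> f -` V)) (\<lambda>y. \<psi> (f (inv_into U \<phi> y))))"

definition smooth_map ::
  "('p, 'e::euclidean_space) chart set \<Rightarrow> ('q, 'f::euclidean_space) chart set \<Rightarrow> ('p \<Rightarrow> 'q) \<Rightarrow> bool"
where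
  "smooth_map A B f \<longleftrightarrow> (\<forall>k. Ck_map k A B f)"

text \<open>The underlying set of a manifold is a whole type, whose sort supplies the Hausdorff and
  second countability requirements. The atlas need not be maximal. The last conjunct says
  that all transition maps are smooth.\<close>

definition smooth_atlas ::
  "('p::{t2_space, second_countable_topology}, 'e::euclidean_space) chart set \<Rightarrow> bool"
where
  "smooth_atlas A \<longleftrightarrow>
     (\<forall>(U, \<phi>)\<in>A. open U \<and> open (\<phi> ` U) \<and> homeomorphism U (\<phi> ` U) \<phi> (inv_into U \<phi>)) \<and>
     (\<Union>(U, \<phi>)\<in>A. U) = UNIV \<and>
     smooth_map A A (\<lambda>p. p)"

definition eucl :: "('e, 'e::euclidean_space) chart set" where
  "eucl = {(UNIV, \<lambda>y. y)}"

section \<open>Tangent spaces and derivatives\<close>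

text \<open>Each point \<open>p\<close> gets a preferred chart, and the tangent space at \<open>p\<close> is the
  model space \<open>'e\<close>, a vector being represented by its components in the preferred chart at \<open>p\<close>.
  A pair \<open>(p, a) :: 'p \<times> 'e\<close> is thus an element of the tangent bundle. The derivative of a map
  at \<open>p\<close> is read off in the preferred charts at \<open>p\<close> and at its image, so the chain rule holds
  without coordinate changes. For a vector space with the atlas \<^const>\<open>eucl\<close> this is the usual
  derivative and the usual identification of every tangent space with the space itself.\<close>

definition chart_at :: "('p, 'e) chart set \<Rightarrow> 'p \<Rightarrow> ('p, 'e) chart" where
  "chart_at A p = (SOME c. c \<in> A \<and> p \<in> fst c)"

definition mderiv ::
  "('p, 'e::euclidean_space) chart set \<Rightarrow> ('q, 'f::euclidean_space) chart set \<Rightarrow> ('p \<Rightarrow> 'q) \<Rightarrow> 'p \<Rightarrow> 'e \<Rightarrow> 'f"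
where
  "mderiv A B f p =
     frechet_derivative
       (\<lambda>y. snd (chart_at B (f p)) (f (inv_into (fst (chart_at A p)) (snd (chart_at A p)) y)))
       (at (snd (chart_at A p) p))"

text \<open>A chart \<open>(U, \<phi>)\<close> induces the bundle chart \<open>(p, a) \<mapsto> (\<phi> p, D\<phi>(p)[a])\<close>. The smooth structure of
  the tangent bundle is the one given by this atlas; the product topology of the type
  \<open>'p \<times> 'e\<close> plays no role.\<close>

definition tangent_atlas ::
  "('p, 'e::euclidean_space) chart set \<Rightarrow> ('p \<times> 'e, 'e \<times> 'e) chart set"
where
  "tangent_atlas A = (\<lambda>(U, \<phi>). (U \<times> UNIV, \<lambda>(p, a). (\<phi> p, mderiv A eucl \<phi> p a))) ` A"

section \<open>Riemannian metrics, distance and retractions\<close>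

text \<open>Here \<open>mderiv eucl A (inv_into U \<phi>) y a\<close> is the value at \<open>inv_into U \<phi> y\<close> of the coordinate vector
  field of the chart \<open>(U, \<phi>)\<close> in direction \<open>a\<close>.\<close>

definition riemannian_metric ::
  "('p, 'e::euclidean_space) chart set \<Rightarrow> ('p \<Rightarrow> 'e \<Rightarrow> 'e \<Rightarrow> real) \<Rightarrow> bool"
where
  "riemannian_metric A g \<longleftrightarrow>
     (\<forall>p. bilinear (g p) \<and> (\<forall>a b. g p a b = g p b a) \<and> (\<forall>a. a \<noteq> 0 \<longrightarrow> g p a a > 0)) \<and>
     (\<forall>(U, \<phi>)\<in>A. \<forall>a b. \<forall>k. Ck_on k (\<phi> ` U)
        (\<lambda>y. g (inv_into U \<phi> y) (mderiv eucl A (inv_into U \<phi>) y a) (mderiv eucl A (inv_into U \<phi>) y b)))"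

definition tnorm :: "('p \<Rightarrow> 'e \<Rightarrow> 'e \<Rightarrow> real) \<Rightarrow> 'p \<Rightarrow> 'e \<Rightarrow> real" where
  "tnorm g p a = sqrt (g p a a)"

text \<open>As in \<^const>\<open>piecewise_C1_differentiable_on\<close>, the speed need not stay bounded at the
  exceptional times; this does not change the infimum of the lengths. The length is an
  extended nonnegative integral, so a curve of infinite length does not contribute, and points
  in different components have distance \<open>\<infinity>\<close>.\<close>

definition piecewise_C1_path ::
  "('p::topological_space, 'e::euclidean_space) chart set \<Rightarrow> (real \<Rightarrow> 'p) \<Rightarrow> bool"
where
  "piecewise_C1_path A \<gamma> \<longleftrightarrow>
     path \<gamma> \<and> (\<exists>T. finite T \<and> Ck_map 1 {({0<..<1} - T, \<lambda>t. t)} A \<gamma>)"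

definition path_length ::
  "('p, 'e::euclidean_space) chart set \<Rightarrow> ('p \<Rightarrow> 'e \<Rightarrow> 'e \<Rightarrow> real) \<Rightarrow> (real \<Rightarrow> 'p) \<Rightarrow> ennreal"
where
  "path_length A g \<gamma> = (\<integral>\<^sup>+ t\<in>{0..1}. ennreal (tnorm g (\<gamma> t) (mderiv eucl A \<gamma> t 1)) \<partial>lborel)"

definition riem_dist ::
  "('p::topological_space, 'e::euclidean_space) chart set \<Rightarrow> ('p \<Rightarrow> 'e \<Rightarrow> 'e \<Rightarrow> real) \<Rightarrow> 'p \<Rightarrow> 'p \<Rightarrow> ennreal"
where
  "riem_dist A g p q =
     (INF \<gamma>\<in>{\<gamma>. piecewise_C1_path A \<gamma> \<and> pathstart \<gamma> = p \<and> pathfinish \<gamma> = q}. path_length A g \<gamma>)"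

definition riem_bounded ::
  "('p::topological_space, 'e::euclidean_space) chart set \<Rightarrow> ('p \<Rightarrow> 'e \<Rightarrow> 'e \<Rightarrow> real) \<Rightarrow> 'p set \<Rightarrow> bool"
where
  "riem_bounded A g S \<longleftrightarrow> (\<exists>r::real. \<forall>p\<in>S. \<forall>q\<in>S. riem_dist A g p q \<le> ennreal r)"

definition riem_retraction ::
  "('p, 'e::euclidean_space) chart set \<Rightarrow> ('p \<Rightarrow> 'e \<Rightarrow> 'p) \<Rightarrow> bool"
where
  "riem_retraction A R \<longleftrightarrow>
     smooth_map (tangent_atlas A) A (\<lambda>(p, a). R p a) \<and>
     (\<forall>p. R p 0 = p) \<and>
     (\<forall>p a. mderiv eucl A (R p) 0 a = a)"

section \<open>Vector optimization\<close>

definition cone_le :: "'f::real_vector set \<Rightarrow> 'f \<Rightarrow> 'f \<Rightarrow> bool" where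
  "cone_le K u v \<longleftrightarrow> v - u \<in> K"

definition dual_cone :: "'f::real_inner set \<Rightarrow> 'f set" where
  "dual_cone K = {\<omega>. \<forall>y\<in>K. \<omega> \<bullet> y \<ge> 0}"

definition support_fun :: "'f::real_inner set \<Rightarrow> 'f \<Rightarrow> real" where
  "support_fun C y = (SUP w\<in>C. y \<bullet> w)"

definition steepest_dir ::
  "('p, 'e::euclidean_space) chart set \<Rightarrow> ('p \<Rightarrow> 'e \<Rightarrow> 'e \<Rightarrow> real) \<Rightarrow> 'f::euclidean_space set \<Rightarrow>
   ('p \<Rightarrow> 'f) \<Rightarrow> 'p \<Rightarrow> 'e"
where
  "steepest_dir A g C F x =
     (THE d. is_arg_min (\<lambda>d. support_fun C (mderiv A eucl F x d) + (tnorm g x d)\<^sup>2 / 2) (\<lambda>_. True) d)"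

text \<open>\<open>psi A C F R x d t\<close> is \<open>\<psi>\<^sub>x\<^sub>,\<^sub>d(td)\<close>.\<close>

definition psi ::
  "('p, 'e::euclidean_space) chart set \<Rightarrow> 'f::euclidean_space set \<Rightarrow> ('p \<Rightarrow> 'f) \<Rightarrow>
   ('p \<Rightarrow> 'e \<Rightarrow> 'p) \<Rightarrow> 'p \<Rightarrow> 'e \<Rightarrow> real \<Rightarrow> real"
where
  "psi A C F R x d t =
     support_fun C (mderiv A eucl F (R x (t *\<^sub>R d)) (mderiv eucl A (R x) (t *\<^sub>R d) d))"

text \<open>Infinite sequences generated by the nonlinear vector Riemannian conjugate gradient method.
  The transported direction \<open>DR\<^sub>x(td)[d]\<close> and \<open>v\<close> at the next iterate lie in the same
  tangent space, so they are added as vectors of the model space.\<close>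

definition rcg_sequences ::
  "('p, 'e::euclidean_space) chart set \<Rightarrow> ('p \<Rightarrow> 'e \<Rightarrow> 'e \<Rightarrow> real) \<Rightarrow> 'f::euclidean_space set \<Rightarrow>
   ('p \<Rightarrow> 'f) \<Rightarrow> ('p \<Rightarrow> 'e \<Rightarrow> 'p) \<Rightarrow> (nat \<Rightarrow> real) \<Rightarrow>
   (nat \<Rightarrow> 'p) \<Rightarrow> (nat \<Rightarrow> 'e) \<Rightarrow> (nat \<Rightarrow> real) \<Rightarrow> bool"
where
  "rcg_sequences A g C F R \<beta> x d t \<longleftrightarrow>
     (\<forall>k. steepest_dir A g C F (x k) \<noteq> 0) \<and>
     d 0 = steepest_dir A g C F (x 0) \<and>
     (\<forall>k. d (Suc k) = steepest_dir A g C F (x (Suc k)) +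
            \<beta> (Suc k) *\<^sub>R mderiv eucl A (R (x k)) (t k *\<^sub>R d k) (d k)) \<and>
     (\<forall>k. t k > 0) \<and>
     (\<forall>k. x (Suc k) = R (x k) (t k *\<^sub>R d k))"

definition beta_CD ::
  "('p, 'e::euclidean_space) chart set \<Rightarrow> ('p \<Rightarrow> 'e \<Rightarrow> 'e \<Rightarrow> real) \<Rightarrow> 'f::euclidean_space set \<Rightarrow>
   ('p \<Rightarrow> 'f) \<Rightarrow> ('p \<Rightarrow> 'e \<Rightarrow> 'p) \<Rightarrow> (nat \<Rightarrow> 'p) \<Rightarrow> (nat \<Rightarrow> 'e) \<Rightarrow> nat \<Rightarrow> real"
where
  "beta_CD A g C F R x d k =
     psi A C F R (x k) (steepest_dir A g C F (x k)) 0 / psi A C F R (x (k - 1)) (d (k - 1)) 0"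

definition strong_wolfe ::
  "('p, 'e::euclidean_space) chart set \<Rightarrow> 'f::euclidean_space set \<Rightarrow> 'f set \<Rightarrow> 'f \<Rightarrow> real \<Rightarrow> real \<Rightarrow>
   ('p \<Rightarrow> 'f) \<Rightarrow> ('p \<Rightarrow> 'e \<Rightarrow> 'p) \<Rightarrow> 'p \<Rightarrow> 'e \<Rightarrow> real \<Rightarrow> bool"
where
  "strong_wolfe A K C e c1 c2 F R x d t \<longleftrightarrow>
     cone_le K (F (R x (t *\<^sub>R d))) (F x + (c1 * t * support_fun C (mderiv A eucl F x d)) *\<^sub>R e) \<and>
     \<bar>psi A C F R x d t\<bar> \<le> c2 * \<bar>psi A C F R x d 0\<bar>"

end

theory Submission
  imports Defs
begin

text \<open>
  The bound on \<open>\<beta>\<^sub>k\<close>, the curvature condition and sublinearity of \<open>\<phi>\<close> give by induction the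
  sufficient descent \<open>\<phi>(DF(x\<^sub>k)[d\<^sub>k]) \<le> -(1 - c\<^sub>2) \<parallel>v(x\<^sub>k)\<parallel>\<^sup>2\<close>. The curvature condition together with
  the Lipschitz assumption bounds the step size below by a multiple of \<open>-\<phi>(DF(x\<^sub>k)[d\<^sub>k]) / \<parallel>d\<^sub>k\<parallel>\<^sup>2\<close>,
  while testing the Armijo condition with one \<open>\<omega> \<in> C\<close> shows that \<open>t\<^sub>k \<phi>(DF(x\<^sub>k)[d\<^sub>k])\<close> is summable.
  Hence \<open>\<phi>(DF(x\<^sub>k)[d\<^sub>k])\<^sup>2 / \<parallel>d\<^sub>k\<parallel>\<^sup>2\<close> is summable (Zoutendijk), which contradicts the divergence of
  \<open>\<Sum> 1 / \<parallel>d\<^sub>k\<parallel>\<^sup>2\<close> if \<open>\<parallel>v(x\<^sub>k)\<parallel>\<close> stays away from zero.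
\<close>

section \<open>Support functions of compact sets\<close>

lemma support_fun_inner_le:
  assumes "compact C" "w \<in> C"
  shows "y \<bullet> w \<le> support_fun C y"
proof -
  have "compact ((\<lambda>w. y \<bullet> w) ` C)"
    by (intro compact_continuous_image continuous_intros assms)
  then have "bdd_above ((\<lambda>w. y \<bullet> w) ` C)"
    by (simp add: bounded_imp_bdd_above compact_imp_bounded)
  then show ?thesis
    unfolding support_fun_def using assms(2) by (rule cSUP_upper[rotated])
qed

lemma support_fun_le:
  assumes "C \<noteq> {}" "\<And>w. w \<in> C \<Longrightarrow> y \<bullet> w \<le> b"
  shows "support_fun C y \<le> b"
  unfolding support_fun_def using assms by (rule cSUP_least)

lemma support_fun_add_le:
  assumes "compact C" "C \<noteq> {}"
  shows "support_fun C (y + z) \<le> support_fun C y + support_fun C z"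
  by (rule support_fun_le[OF assms(2)])
    (simp add: inner_add_left add_mono support_fun_inner_le[OF assms(1)])

lemma support_fun_zero:
  assumes "C \<noteq> {}"
  shows "support_fun C 0 = 0"
  using assms by (simp add: support_fun_def)

lemma support_fun_scaleR:
  assumes C: "compact C" "C \<noteq> {}" and "0 \<le> r"
  shows "support_fun C (r *\<^sub>R y) = r * support_fun C y"
proof (cases "r = 0")
  case True
  then show ?thesis by (simp add: support_fun_zero[OF C(2)])
next
  case False
  \<comment> \<open>One inequality is enough: the reverse one is the same bound with factor
    \<open>inverse r\<close> at the vector \<open>r *\<^sub>R y\<close>.\<close>
  have le: "support_fun C (s *\<^sub>R z) \<le> s * support_fun C z" if "0 < s" for s z
    by (rule support_fun_le[OF C(2)]) (use that support_fun_inner_le[OF C(1)] in simp)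
  from False assms have "0 < r" by simp
  with le[of r y] le[of "inverse r" "r *\<^sub>R y"] show ?thesis
    by (simp add: field_simps)
qed

lemma support_fun_le_norm:
  assumes "compact C" "C \<noteq> {}"
  obtains B where "0 < B" "\<And>y. support_fun C y \<le> B * norm y"
proof -
  obtain B where B: "0 < B" "\<And>w. w \<in> C \<Longrightarrow> norm w \<le> B"
    using assms(1) bounded_pos compact_imp_bounded by metis
  have "support_fun C y \<le> B * norm y" for y
  proof (rule support_fun_le[OF assms(2)])
    fix w assume "w \<in> C"
    have "y \<bullet> w \<le> norm y * norm w" by (rule norm_cauchy_schwarz)
    also have "\<dots> \<le> norm y * B" using B(2)[OF \<open>w \<in> C\<close>] by (simp add: mult_left_mono)
    finally show "y \<bullet> w \<le> B * norm y" by (simp add: mult.commute)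
  qed
  with B(1) show thesis using that by blast
qed

section \<open>Minimizing a sublinear function plus a positive definite quadratic form\<close>

lemma bilinear_pos_coercive:
  fixes q :: "'e::euclidean_space \<Rightarrow> 'e \<Rightarrow> real"
  assumes q: "bilinear q" "\<And>a. a \<noteq> 0 \<Longrightarrow> 0 < q a a"
  obtains m where "0 < m" "\<And>a. m * (norm a)\<^sup>2 \<le> q a a"
proof -
  have cont: "continuous_on UNIV (\<lambda>a. q a a)"
    by (rule bounded_bilinear.continuous_on[OF q(1)[unfolded bilinear_conv_bounded_bilinear]
          continuous_on_id continuous_on_id])
  have ne: "sphere (0::'e) 1 \<noteq> {}" by simp
  \<comment> \<open>The minimum over the compact unit sphere is positive and serves as
    \<open>m\<close>; quadratic homogeneity carries the bound to all vectors.\<close>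
  obtain b where b: "b \<in> sphere 0 1" "\<And>a. a \<in> sphere 0 1 \<Longrightarrow> q b b \<le> q a a"
    using continuous_attains_inf[OF compact_sphere ne continuous_on_subset[OF cont subset_UNIV]]
    by blast
  have "q b b * (norm a)\<^sup>2 \<le> q a a" for a
  proof (cases "a = 0")
    case True
    then show ?thesis using q(1) by (simp add: bilinear_lzero)
  next
    case False
    have "q b b \<le> q (inverse (norm a) *\<^sub>R a) (inverse (norm a) *\<^sub>R a)"
      using False by (intro b(2)) simp
    also have "\<dots> = q a a / (norm a)\<^sup>2"
      using q(1) by (simp add: bilinear_lmul bilinear_rmul power2_eq_square field_simps)
    finally show ?thesis using False by (simp add: field_simps)
  qed
  moreover have "0 < q b b" using b(1) by (intro q(2)) auto
  ultimately show thesis using that by blast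
qed

text \<open>Coercivity of \<open>q\<close> gives existence, its strict convexity gives uniqueness,
  and stationarity along the ray through the minimizer gives the value of \<open>h\<close>
  there.\<close>

lemma sublinear_plus_quadratic_argmin:
  fixes h :: "'e::euclidean_space \<Rightarrow> real" and q :: "'e \<Rightarrow> 'e \<Rightarrow> real"
  assumes add: "\<And>a b. h (a + b) \<le> h a + h b"
    and scale: "\<And>r a. 0 \<le> r \<Longrightarrow> h (r *\<^sub>R a) = r * h a"
    and bound: "\<And>a. h a \<le> B * norm a"
    and q: "bilinear q" "\<And>a b. q a b = q b a" "\<And>a. a \<noteq> 0 \<Longrightarrow> 0 < q a a"
  defines "f \<equiv> \<lambda>a. h a + q a a / 2"
  shows "\<exists>!v. is_arg_min f (\<lambda>_. True) v"
    and "is_arg_min f (\<lambda>_. True) v \<Longrightarrow> h v = - q v v"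
proof -
  have argmin: "is_arg_min f (\<lambda>_. True) v \<longleftrightarrow> (\<forall>a. f v \<le> f a)" for v
    by (auto simp: is_arg_min_def not_less)
  note q_simps = bilinear_ladd[OF q(1)] bilinear_radd[OF q(1)] bilinear_lmul[OF q(1)]
    bilinear_rmul[OF q(1)] bilinear_lsub[OF q(1)] bilinear_rsub[OF q(1)]
  have h0: "h 0 = 0" using scale[of 0 0] by simp
  obtain m where m: "0 < m" "\<And>a. m * (norm a)\<^sup>2 \<le> q a a"
    using bilinear_pos_coercive[OF q(1,3)] by blast
  \<comment> \<open>Sublinear functions are convex, and finite convex functions on a Euclidean space
    are continuous.\<close>
  have hcont: "continuous_on UNIV h"
    by (rule convex_on_continuous) (auto intro!: convex_onI simp: scale order_trans[OF add])
  have "continuous_on UNIV (\<lambda>a. q a a)"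
    by (rule bounded_bilinear.continuous_on[OF q(1)[unfolded bilinear_conv_bounded_bilinear]
          continuous_on_id continuous_on_id])
  then have fcont: "continuous_on UNIV f"
    unfolding f_def by (intro continuous_intros hcont) auto
  \<comment> \<open>Beyond this radius \<open>q a a / 2\<close> outweighs
    \<open>\<bar>B\<bar> * norm a\<close>, so \<open>f\<close> is nonnegative there and cannot drop
    below \<open>f 0 = 0\<close>.\<close>
  define r where "r = 2 * \<bar>B\<bar> / m"
  have r0: "0 \<le> r" using m(1) by (simp add: r_def)
  obtain v where v: "v \<in> cball 0 r" "\<And>a. a \<in> cball 0 r \<Longrightarrow> f v \<le> f a"
    using continuous_attains_inf[OF compact_cball _ continuous_on_subset[OF fcont subset_UNIV],
        of 0 r] r0
    by auto
  have "f v \<le> f a" for a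
  proof (cases "a \<in> cball 0 r")
    case False
    then have "r \<le> norm a" by simp
    then have "\<bar>B\<bar> * norm a \<le> (m * norm a / 2) * norm a"
      using m(1) by (intro mult_right_mono) (auto simp: r_def field_simps)
    also have "\<dots> = m * (norm a)\<^sup>2 / 2" by (simp add: power2_eq_square)
    also have "\<dots> \<le> q a a / 2" using m(2)[of a] by simp
    finally have *: "\<bar>B\<bar> * norm a \<le> q a a / 2" .
    \<comment> \<open>Subadditivity turns the upper bound on \<open>h (- a)\<close> into a lower
      bound on \<open>h a\<close>.\<close>
    have "0 \<le> h a + h (- a)" using add[of a "- a"] h0 by simp
    moreover have "h (- a) \<le> \<bar>B\<bar> * norm a"
      using bound[of "- a"] mult_right_mono[OF abs_ge_self[of B], of "norm a"] by simp
    ultimately have "0 \<le> f a" using * by (simp add: f_def)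
    moreover have "f v \<le> f 0" using r0 by (intro v(2)) simp
    ultimately show ?thesis by (simp add: f_def h0 bilinear_lzero[OF q(1)])
  qed (rule v(2))
  then have ex: "is_arg_min f (\<lambda>_. True) v" by (simp add: argmin)
  have uniq: "a = b" if ab: "is_arg_min f (\<lambda>_. True) a" "is_arg_min f (\<lambda>_. True) b" for a b
  proof (rule ccontr)
    assume "a \<noteq> b"
    then have "0 < q (a - b) (a - b)" by (intro q(3)) simp
    \<comment> \<open>The minimal values agree, yet at the midpoint the quadratic part of
      \<open>f\<close> lies below the average by \<open>q (a - b) (a - b) / 8\<close>.\<close>
    moreover have "f (a - b + b) = f b" and "f a \<le> f ((1/2) *\<^sub>R (a + b))"
      using ab unfolding argmin by (auto intro: antisym)
    moreover have "h ((1/2) *\<^sub>R (a + b)) \<le> (h a + h b) / 2"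
      using add[of a b] by (simp add: scale)
    ultimately show False
      by (simp add: f_def q_simps q(2)[of b a] field_simps)
  qed
  show "\<exists>!v. is_arg_min f (\<lambda>_. True) v" using ex uniq by blast
  show "h v = - q v v" if "is_arg_min f (\<lambda>_. True) v" for v
  proof (rule ccontr)
    assume ne: "h v \<noteq> - q v v"
    have scaled: "f v \<le> s * h v + s\<^sup>2 * (q v v / 2)" if "0 \<le> s" for s
    proof -
      have "f v \<le> f (s *\<^sub>R v)" using \<open>is_arg_min f _ v\<close> by (simp add: argmin)
      also have "\<dots> = s * h v + s\<^sup>2 * (q v v / 2)"
        using that by (simp add: f_def scale q_simps power2_eq_square)
      finally show ?thesis .
    qed
    have "v \<noteq> 0" using ne h0 by (auto simp: bilinear_lzero[OF q(1)])
    then have qv: "0 < q v v" by (rule q(3))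
    have "0 \<ge> h v + q v v / 2" using scaled[of 0] by (simp add: f_def)
    then have "h v < 0" using qv by linarith
    \<comment> \<open>The vertex of the parabola in \<open>scaled\<close>; minimality of
      \<open>v\<close> on its ray forces it to be \<open>1\<close>. The comparison with
      \<open>0\<close> above ensures that this \<open>s\<close> is an admissible, nonnegative
      factor.\<close>
    define s where "s = - h v / q v v"
    have s: "h v = - s * q v v" using qv by (simp add: s_def)
    have "0 \<le> s" using \<open>h v < 0\<close> qv by (simp add: s_def divide_nonpos_nonneg)
    from scaled[OF this] have "(s - 1)\<^sup>2 * q v v \<le> 0"
      unfolding f_def s by (simp add: power2_eq_square algebra_simps)
    then have "s = 1" using qv by (simp add: mult_le_0_iff)
    with s ne show False by simp
  qed
qed

section \<open>Preferred charts and the chain rule along a retraction\<close>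

lemma chart_at_eucl [simp]: "chart_at eucl y = (UNIV, \<lambda>y. y)"
  unfolding chart_at_def by (rule some_equality) (auto simp: eucl_def)

lemma inv_into_UNIV_ident [simp]: "inv_into UNIV (\<lambda>y. y) y = y"
  by (metis UNIV_I f_inv_into_f image_ident)

lemma chart_at:
  assumes "smooth_atlas A"
  shows "chart_at A p \<in> A" "p \<in> fst (chart_at A p)"
proof -
  from assms have "p \<in> (\<Union>(U, \<phi>)\<in>A. U)" by (simp add: smooth_atlas_def)
  then have "\<exists>c. c \<in> A \<and> p \<in> fst c" by auto
  then have "chart_at A p \<in> A \<and> p \<in> fst (chart_at A p)"
    unfolding chart_at_def by (rule someI_ex)
  then show "chart_at A p \<in> A" "p \<in> fst (chart_at A p)" by auto
qed

lemma smooth_atlas_chart: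
  assumes "smooth_atlas A" "(U, \<phi>) \<in> A"
  shows "open (\<phi> ` U)" "inj_on \<phi> U"
proof -
  from assms have "open (\<phi> ` U)" "homeomorphism U (\<phi> ` U) \<phi> (inv_into U \<phi>)"
    by (auto simp: smooth_atlas_def)
  then show "open (\<phi> ` U)" "inj_on \<phi> U"
    by (auto simp: homeomorphism_def intro: inj_on_inverseI)
qed

text \<open>The preferred chart expressed in itself is the identity on an open set, so its bundle
  chart leaves the components of vectors at \<open>p\<close> unchanged.\<close>

lemma mderiv_chart_at:
  assumes "smooth_atlas A" "chart_at A p = (U, \<phi>)"
  shows "mderiv A eucl \<phi> p a = a"
proof -
  from chart_at[OF assms(1), of p] assms(2) have U: "(U, \<phi>) \<in> A" "p \<in> U" by auto
  have "((\<lambda>y. \<phi> (inv_into U \<phi> y)) has_derivative (\<lambda>a. a)) (at (\<phi> p))"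
    by (rule has_derivative_transform_within_open[OF has_derivative_ident
          smooth_atlas_chart(1)[OF assms(1) U(1)]])
      (use U(2) in \<open>auto simp: f_inv_into_f\<close>)
  then show ?thesis
    by (simp add: mderiv_def assms(2) frechet_derivative_at[symmetric])
qed

text \<open>The preferred chart belongs to the atlas, so the coordinate expression is differentiable
  at \<open>\<phi> p\<close> and \<open>frechet_derivative\<close> is not an arbitrary
  choice.\<close>

lemma Ck_map_1_has_derivative:
  assumes A: "smooth_atlas A" and F: "Ck_map 1 A eucl F" and p: "chart_at A p = (U, \<phi>)"
  shows "((\<lambda>y. F (inv_into U \<phi> y)) has_derivative mderiv A eucl F p) (at (\<phi> p))"
proof -
  from chart_at[OF A, of p] p have U: "(U, \<phi>) \<in> A" "p \<in> U" by auto
  with F have "(\<lambda>y. F (inv_into U \<phi> y)) differentiable (at (\<phi> p))"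
    by (fastforce simp: Ck_map_def eucl_def)
  then show ?thesis
    by (simp add: mderiv_def p frechet_derivative_works)
qed

text \<open>In the bundle chart induced by the preferred chart \<open>(U, \<phi>)\<close> at \<open>p\<close>, the fibre over \<open>p\<close> is
  \<open>{\<phi> p} \<times> 'e\<close> with its identical parametrization, so \<open>R p\<close> is the restriction of the
  coordinate expression of the retraction to that slice.\<close>

lemma riem_retraction_has_derivative:
  fixes A :: "('p::{t2_space, second_countable_topology}, 'e::euclidean_space) chart set"
  assumes A: "smooth_atlas A" and R: "riem_retraction A R" and V: "chart_at A (R p a) = (V, \<psi>)"
  obtains S where "open S" "a \<in> S" "\<And>b. b \<in> S \<Longrightarrow> R p b \<in> V"
    "((\<lambda>b. \<psi> (R p b)) has_derivative mderiv eucl A (R p) a) (at a)"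
proof -
  obtain U \<phi> where p: "chart_at A p = (U, \<phi>)" by fastforce
  from chart_at[OF A, of p] p have U: "(U, \<phi>) \<in> A" "p \<in> U" by auto
  from chart_at[OF A, of "R p a"] V have V': "(V, \<psi>) \<in> A" "R p a \<in> V" by auto
  define \<Phi> where "\<Phi> = (\<lambda>(p, a). (\<phi> p, mderiv A eucl \<phi> p a))"
  define Q where "Q = (\<lambda>(p, a). R p a)"
  define X where "X = \<Phi> ` ((U \<times> UNIV) \<inter> Q -` V)"
  define G where "G = (\<lambda>y. \<psi> (Q (inv_into (U \<times> UNIV) \<Phi> y)))"
  have "(U \<times> UNIV, \<Phi>) \<in> tangent_atlas A"
    unfolding tangent_atlas_def \<Phi>_def using U(1) by (force simp: case_prod_beta)
  moreover have "Ck_map 1 (tangent_atlas A) A Q"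
    using R by (simp add: riem_retraction_def smooth_map_def Q_def)
  ultimately have G: "Ck_on 1 X G"
    using V'(1) unfolding Ck_map_def X_def G_def by fast
  have \<Phi>p: "\<Phi> (p, b) = (\<phi> p, b)" for b
    by (simp add: \<Phi>_def mderiv_chart_at[OF A p])
  \<comment> \<open>\<open>inv_into\<close> picks some preimage under \<open>\<Phi>\<close>;
    injectivity of \<open>\<phi>\<close> makes it unique over \<open>\<phi> p\<close>.\<close>
  have eq: "z = (p, b)" if z: "z \<in> U \<times> UNIV" "\<Phi> z = (\<phi> p, b)" for z b
  proof -
    obtain q c where [simp]: "z = (q, c)" by fastforce
    have "\<phi> q = \<phi> p" "q \<in> U" using z by (auto simp: \<Phi>_def)
    then have "q = p" using smooth_atlas_chart(2)[OF A U(1)] U(2) by (auto dest: inj_onD)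
    with z \<Phi>p show ?thesis by simp
  qed
  have inv: "inv_into (U \<times> UNIV) \<Phi> (\<phi> p, b) = (p, b)" for b
  proof -
    have "(\<phi> p, b) \<in> \<Phi> ` (U \<times> UNIV)" 
      using U(2) by (intro image_eqI[of _ _ "(p, b)"]) (auto simp: \<Phi>p)
    then show ?thesis by (intro eq inv_into_into f_inv_into_f)
  qed
  have Gp: "G (\<phi> p, b) = \<psi> (R p b)" for b by (simp add: G_def inv Q_def)
  define S where "S = (\<lambda>b. (\<phi> p, b)) -` X"
  have "open S"
    unfolding S_def using G by (intro open_vimage continuous_intros) simp
  moreover have "a \<in> S"
    unfolding S_def X_def using \<Phi>p[of a] U(2) V'(2)
    by (auto intro!: image_eqI[of _ _ "(p, a)"] simp: Q_def)
  moreover have "R p b \<in> V" if "b \<in> S" for b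
  proof -
    have "(\<phi> p, b) \<in> \<Phi> ` ((U \<times> UNIV) \<inter> Q -` V)" using that by (simp add: S_def X_def)
    then obtain z where "(\<phi> p, b) = \<Phi> z" "z \<in> (U \<times> UNIV) \<inter> Q -` V" by (rule imageE)
    then have z: "z \<in> U \<times> UNIV" "Q z \<in> V" "\<Phi> z = (\<phi> p, b)" by simp_all
    show ?thesis using z(2) eq[OF z(1,3)] by (simp add: Q_def)
  qed
  moreover have "((\<lambda>b. \<psi> (R p b)) has_derivative mderiv eucl A (R p) a) (at a)"
  proof -
    have "G differentiable (at (\<phi> p, a))" using G \<open>a \<in> S\<close> by (simp add: S_def)
    then have "(G \<circ> (\<lambda>b. (\<phi> p, b))) differentiable (at a)"
      by (intro differentiable_chain_at) (auto intro!: derivative_intros simp: differentiable_def)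
    then show ?thesis
      by (simp add: o_def Gp mderiv_def V frechet_derivative_works)
  qed
  ultimately show thesis using that by blast
qed

text \<open>Near \<open>a\<close> the map \<open>R p\<close> stays in the preferred chart domain at
  \<open>R p a\<close>, so \<open>F \<circ> R p\<close> factors through that chart. This links the
  Lipschitz assumption on \<open>F \<circ> R p\<close> to \<open>psi\<close>.\<close>

lemma mderiv_compose_retraction:
  fixes A :: "('p::{t2_space, second_countable_topology}, 'e::euclidean_space) chart set"
  assumes A: "smooth_atlas A" and F: "Ck_map 1 A eucl F" and R: "riem_retraction A R"
  shows "mderiv eucl eucl (F \<circ> R p) a b = mderiv A eucl F (R p a) (mderiv eucl A (R p) a b)"
proof -
  obtain V \<psi> where V: "chart_at A (R p a) = (V, \<psi>)" by fastforce
  then have V': "(V, \<psi>) \<in> A" using chart_at[OF A, of "R p a"] by auto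
  obtain S where S: "open S" "a \<in> S" "\<And>b. b \<in> S \<Longrightarrow> R p b \<in> V"
    and dR: "((\<lambda>b. \<psi> (R p b)) has_derivative mderiv eucl A (R p) a) (at a)"
    using riem_retraction_has_derivative[OF A R V] by blast
  have "((\<lambda>b. F (inv_into V \<psi> (\<psi> (R p b)))) has_derivative
      (\<lambda>b. mderiv A eucl F (R p a) (mderiv eucl A (R p) a b))) (at a)"
    using dR Ck_map_1_has_derivative[OF A F V] by (rule has_derivative_compose)
  then have "((F \<circ> R p) has_derivative
      (\<lambda>b. mderiv A eucl F (R p a) (mderiv eucl A (R p) a b))) (at a)"
    by (rule has_derivative_transform_within_open[OF _ S(1,2)])
      (simp add: S(3) inv_into_f_f[OF smooth_atlas_chart(2)[OF A V']])
  then show ?thesis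
    by (simp add: mderiv_def[of eucl eucl] frechet_derivative_at[symmetric] o_def)
qed

lemma linear_mderiv:
  assumes "smooth_atlas A" "Ck_map 1 A eucl F"
  shows "linear (mderiv A eucl F p)"
proof -
  obtain U \<phi> where "chart_at A p = (U, \<phi>)" by fastforce
  from Ck_map_1_has_derivative[OF assms this] show ?thesis by (rule has_derivative_linear)
qed

lemma linear_mderiv_retraction:
  assumes "smooth_atlas A" "riem_retraction A R"
  shows "linear (mderiv eucl A (R p) a)"
proof -
  obtain V \<psi> where "chart_at A (R p a) = (V, \<psi>)" by fastforce
  from riem_retraction_has_derivative[OF assms this] show ?thesis
    using has_derivative_linear by blast
qed

section \<open>The steepest descent direction and the growth of \<open>psi\<close>\<close>

lemma steepest_dir_eq:
  assumes A: "smooth_atlas A" "riemannian_metric A g" and F: "Ck_map 1 A eucl F"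
    and C: "compact C" "C \<noteq> {}"
  shows "support_fun C (mderiv A eucl F p (steepest_dir A g C F p))
    = - (tnorm g p (steepest_dir A g C F p))\<^sup>2"
proof -
  define h where "h = (\<lambda>a. support_fun C (mderiv A eucl F p a))"
  note lin = linear_mderiv[OF A(1) F, of p]
  obtain B where B: "0 < B" "\<And>y. support_fun C y \<le> B * norm y"
    using support_fun_le_norm[OF C] by blast
  obtain B' where B': "\<And>a. norm (mderiv A eucl F p a) \<le> B' * norm a"
    using linear_bounded[OF lin] by blast
  have bound: "h a \<le> (B * B') * norm a" for a
    using B(2)[of "mderiv A eucl F p a"] mult_left_mono[OF B'[of a], of B] B(1)
    unfolding h_def by (simp add: mult.assoc, linarith)
  have q: "bilinear (g p)" "\<And>a b. g p a b = g p b a" "\<And>a. a \<noteq> 0 \<Longrightarrow> 0 < g p a a"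
    using A(2) by (auto simp: riemannian_metric_def)
  have sq: "(tnorm g p a)\<^sup>2 = g p a a" for a
  proof (cases "a = 0")
    case True
    then show ?thesis by (simp add: tnorm_def bilinear_lzero[OF q(1)])
  next
    case False
    with q(3)[of a] show ?thesis by (simp add: tnorm_def)
  qed
  have add: "h (a + b) \<le> h a + h b" for a b
    using support_fun_add_le[OF C] by (simp add: h_def linear_add[OF lin])
  have scale: "h (r *\<^sub>R a) = r * h a" if "0 \<le> r" for r a
    using support_fun_scaleR[OF C that] by (simp add: h_def linear_scale[OF lin])
  have "\<exists>!v. is_arg_min (\<lambda>a. h a + g p a a / 2) (\<lambda>_. True) v"
    by (rule sublinear_plus_quadratic_argmin(1)) (fact add scale bound q)+
  \<comment> \<open>Existence and uniqueness make the definite description in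
    \<open>steepest_dir\<close> denote an actual minimizer.\<close>
  from theI'[OF this] have "is_arg_min (\<lambda>a. h a + g p a a / 2) (\<lambda>_. True) (steepest_dir A g C F p)"
    by (simp add: steepest_dir_def sq h_def)
  then have "h (steepest_dir A g C F p) = - g p (steepest_dir A g C F p) (steepest_dir A g C F p)"
    by (rule sublinear_plus_quadratic_argmin(2)[rotated -1]) (fact add scale bound q)+
  then show ?thesis by (simp add: sq h_def)
qed

lemma psi_zero:
  assumes "riem_retraction A R"
  shows "psi A C F R p a 0 = support_fun C (mderiv A eucl F p a)"
  using assms by (simp add: psi_def riem_retraction_def)

text \<open>By sublinearity the increase is at most \<open>B\<close> times the norm of the
  difference of derivatives. The Lipschitz bound concerns unit vectors, so \<open>a\<close> is
  written as \<open>n *\<^sub>R b\<close>: one factor \<open>n\<close> comes from the parameter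
  \<open>s * n\<close>, the other from linearity in the direction.\<close>

lemma psi_diff_le:
  assumes A: "smooth_atlas A" "riemannian_metric A g" and F: "Ck_map 1 A eucl F"
    and R: "riem_retraction A R" and C: "compact C" "C \<noteq> {}"
    and B: "0 < B" "\<And>y. support_fun C y \<le> B * norm y"
    and lip: "\<And>b r. tnorm g p b = 1 \<Longrightarrow> 0 \<le> r \<Longrightarrow>
      norm (mderiv eucl eucl (F \<circ> R p) (r *\<^sub>R b) b - mderiv eucl eucl (F \<circ> R p) 0 b) \<le> L * r"
    and "a \<noteq> 0" "0 \<le> s"
  shows "psi A C F R p a s - psi A C F R p a 0 \<le> B * L * s * (tnorm g p a)\<^sup>2"
proof -
  define n where "n = tnorm g p a"
  define D where "D = (\<lambda>u. mderiv eucl eucl (F \<circ> R p) u)"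
  have D: "D u b = mderiv A eucl F (R p u) (mderiv eucl A (R p) u b)" for u b
    unfolding D_def by (rule mderiv_compose_retraction[OF A(1) F R])
  have lin: "linear (D u)" for u
  proof -
    have "D u = mderiv A eucl F (R p u) \<circ> mderiv eucl A (R p) u"
      by (simp add: fun_eq_iff D)
    then show ?thesis
      using linear_compose[OF linear_mderiv_retraction[OF A(1) R] linear_mderiv[OF A(1) F]]
      by simp
  qed
  have q: "bilinear (g p)" "0 < g p a a"
    using A(2) \<open>a \<noteq> 0\<close> by (auto simp: riemannian_metric_def)
  then have n: "0 < n" "n * n = g p a a" by (auto simp: n_def tnorm_def)
  define b where "b = inverse n *\<^sub>R a"
  have a: "a = n *\<^sub>R b" using n by (simp add: b_def)
  have "g p b b = inverse n * (inverse n * (n * n))"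
    unfolding n(2) by (simp add: b_def bilinear_lmul[OF q(1)] bilinear_rmul[OF q(1)])
  then have "tnorm g p b = 1" using n(1) by (simp add: tnorm_def field_simps)
  then have "norm (D (s *\<^sub>R a) b - D 0 b) \<le> L * (s * n)"
    using lip[of b "s * n"] \<open>0 \<le> s\<close> n(1) by (simp add: a D_def)
  then have "n * norm (D (s *\<^sub>R a) b - D 0 b) \<le> n * (L * (s * n))"
    using n(1) by (intro mult_left_mono) auto
  moreover have "D u a = n *\<^sub>R D u b" for u using linear_scale[OF lin] a by metis
  ultimately have "norm (D (s *\<^sub>R a) a - D 0 a) \<le> L * s * n\<^sup>2"
    using n(1) by (simp add: scaleR_diff_right[symmetric] power2_eq_square mult_ac)
  then have "B * norm (D (s *\<^sub>R a) a - D 0 a) \<le> B * (L * s * n\<^sup>2)"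
    using B(1) by (intro mult_left_mono) auto
  moreover have "support_fun C (D (s *\<^sub>R a) a) \<le>
      support_fun C (D (s *\<^sub>R a) a - D 0 a) + support_fun C (D 0 a)"
    using support_fun_add_le[OF C, of "D (s *\<^sub>R a) a - D 0 a" "D 0 a"] by simp
  ultimately show ?thesis
    using B(2)[of "D (s *\<^sub>R a) a - D 0 a"]
    by (simp add: psi_def D[symmetric] n_def mult.assoc)
qed

section \<open>Sufficient descent of the conjugate gradient directions\<close>

lemma rcg_sufficient_descent:
  assumes A: "smooth_atlas A" "riemannian_metric A g" and F: "Ck_map 1 A eucl F"
    and R: "riem_retraction A R" and C: "compact C" "C \<noteq> {}" and c2: "0 < c2" "c2 < 1"
    and seq: "rcg_sequences A g C F R \<beta> x d t"
    and beta: "\<forall>k\<ge>1. 0 \<le> \<beta> k \<and> \<beta> k \<le> beta_CD A g C F R x d k"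
    and wolfe: "\<And>k. \<bar>psi A C F R (x k) (d k) (t k)\<bar> \<le> c2 * \<bar>psi A C F R (x k) (d k) 0\<bar>"
  shows "support_fun C (mderiv A eucl F (x k) (d k))
    \<le> - (1 - c2) * (tnorm g (x k) (steepest_dir A g C F (x k)))\<^sup>2"
proof -
  define v where "v = (\<lambda>k. steepest_dir A g C F (x k))"
  define w where "w = (\<lambda>k. (tnorm g (x k) (v k))\<^sup>2)"
  define J where "J = (\<lambda>k. support_fun C (mderiv A eucl F (x k) (d k)))"
  have Jv: "support_fun C (mderiv A eucl F (x k) (v k)) = - w k" for k
    unfolding v_def w_def by (rule steepest_dir_eq[OF A F C])
  have w_pos: "0 < w k" for k
  proof -
    have "v k \<noteq> 0" using seq by (simp add: rcg_sequences_def v_def)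
    then have "0 < g (x k) (v k) (v k)" using A(2) by (auto simp: riemannian_metric_def)
    then show ?thesis by (simp add: w_def tnorm_def)
  qed
  have "J k \<le> - (1 - c2) * w k"
  proof (induction k)
    case 0
    have "J 0 = - w 0" using seq Jv[of 0] by (simp add: rcg_sequences_def J_def v_def)
    then show ?case using c2 w_pos[of 0] by (simp add: algebra_simps)
  next
    case (Suc k)
    define T where "T = mderiv eucl A (R (x k)) (t k *\<^sub>R d k) (d k)"
    define \<tau> where "\<tau> = support_fun C (mderiv A eucl F (x (Suc k)) T)"
    have xs: "x (Suc k) = R (x k) (t k *\<^sub>R d k)" and ds: "d (Suc k) = v (Suc k) + \<beta> (Suc k) *\<^sub>R T"
      using seq by (auto simp: rcg_sequences_def v_def T_def)
    have "0 < (1 - c2) * w k" using c2 w_pos[of k] by simp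
    with Suc have neg: "J k < 0" by (simp add: algebra_simps)
    have "psi A C F R (x k) (d k) (t k) = \<tau>" by (simp add: psi_def \<tau>_def T_def xs)
    with wolfe[of k] neg have \<tau>: "\<tau> \<le> c2 * - J k" by (simp add: psi_zero[OF R] J_def)
    have "0 \<le> \<beta> (Suc k)" and "\<beta> (Suc k) \<le> beta_CD A g C F R x d (Suc k)"
      using beta by auto
    \<comment> \<open>Since \<open>J k < 0\<close>, clearing the negative denominator of
      \<open>beta_CD\<close> bounds \<open>\<beta> (Suc k) * - J k\<close> by
      \<open>w (Suc k)\<close>; the transported term then costs at most
      \<open>c2 * w (Suc k)\<close>.\<close>
    then have b: "0 \<le> \<beta> (Suc k)" "\<beta> (Suc k) * - J k \<le> w (Suc k)"
      using neg Jv[of "Suc k"] by (auto simp: beta_CD_def psi_zero[OF R] J_def v_def field_simps)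
    note lin = linear_mderiv[OF A(1) F, of "x (Suc k)"]
    have "J (Suc k) = support_fun C (mderiv A eucl F (x (Suc k)) (v (Suc k))
        + \<beta> (Suc k) *\<^sub>R mderiv A eucl F (x (Suc k)) T)"
      by (simp add: J_def ds linear_add[OF lin] linear_scale[OF lin])
    also have "\<dots> \<le> - w (Suc k) + \<beta> (Suc k) * \<tau>"
      using support_fun_add_le[OF C] b(1) unfolding \<tau>_def Jv[symmetric]
      by (metis support_fun_scaleR[OF C b(1)])
    also have "\<beta> (Suc k) * \<tau> \<le> \<beta> (Suc k) * (c2 * - J k)"
      using \<tau> b(1) by (rule mult_left_mono)
    also have "\<dots> = c2 * (\<beta> (Suc k) * - J k)" by simp
    also have "\<dots> \<le> c2 * w (Suc k)" using b(2) c2(1) by (intro mult_left_mono) auto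
    finally show ?case by (simp add: algebra_simps)
  qed
  then show ?thesis by (simp add: J_def w_def v_def)
qed

section \<open>Summability of the decrease and the limit inferior\<close>

theorem theorem4p3:
  fixes K C :: "(real^'m) set" and e :: "real^'m" and c1 c2 :: real
    and A :: "('p::{t2_space, second_countable_topology}, real^'n) chart set"
    and g :: "'p \<Rightarrow> real^'n \<Rightarrow> real^'n \<Rightarrow> real"
    and F :: "'p \<Rightarrow> real^'m"
    and R :: "'p \<Rightarrow> real^'n \<Rightarrow> 'p"
    and x :: "nat \<Rightarrow> 'p" and d :: "nat \<Rightarrow> real^'n" and t \<beta> :: "nat \<Rightarrow> real"
    and \<L> :: "'p set"
  assumes K: "closed K" "convex K" "cone K" "K \<inter> uminus ` K = {0}" "interior K \<noteq> {}"
    and C: "compact C" "C \<subseteq> dual_cone K - {0}" "dual_cone K = cone hull (convex hull C)"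
    and e: "e \<in> K" "\<forall>\<omega>\<in>C. 0 < \<omega> \<bullet> e \<and> \<omega> \<bullet> e \<le> 1"
    and c: "0 < c1" "c1 < c2" "c2 < 1"
    and manifold: "smooth_atlas A" "riemannian_metric A g"
    and F: "Ck_map 1 A eucl F"
    and R: "riem_retraction A R"
    and sequences: "rcg_sequences A g C F R \<beta> x d t"
    and i: "\<exists>L>0. \<forall>y a s. tnorm g y a = 1 \<and> s \<ge> 0 \<longrightarrow>
        norm (mderiv eucl eucl (F \<circ> R y) (s *\<^sub>R a) a - mderiv eucl eucl (F \<circ> R y) 0 a) \<le> L * s"
    and level: "\<L> = {y. cone_le K (F y) (F (x 0))}"
    and ii: "\<forall>G :: nat \<Rightarrow> real^'m.
        (\<forall>k. G k \<in> F ` \<L>) \<and> (\<forall>k. cone_le K (G (Suc k)) (G k)) \<longrightarrow> (\<exists>\<G>. \<forall>k. cone_le K \<G> (G k))"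
    and iii: "riem_bounded A g \<L>"
    and iv: "filterlim (\<lambda>N. \<Sum>k<N. 1 / (tnorm g (x k) (d k))\<^sup>2) at_top sequentially"
    and beta: "\<forall>k\<ge>1. 0 \<le> \<beta> k \<and> \<beta> k \<le> beta_CD A g C F R x d k"
    and wolfe: "\<forall>k. strong_wolfe A K C e c1 c2 F R (x k) (d k) (t k)"
  shows "liminf (\<lambda>k. ereal (tnorm g (x k) (steepest_dir A g C F (x k)))) = 0"
proof -
  define v where "v = (\<lambda>k. steepest_dir A g C F (x k))"
  define J where "J = (\<lambda>k. support_fun C (mderiv A eucl F (x k) (d k)))"
  define n where "n = (\<lambda>k. tnorm g (x k) (d k))"
  \<comment> \<open>An empty \<open>C\<close> would generate the empty cone, whereas the dual cone
    contains \<open>0\<close>.\<close>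
  have "0 \<in> dual_cone K" by (simp add: dual_cone_def)
  with C(3) have "C \<noteq> {}" by (auto simp: cone_hull_expl)
  note C' = C(1) this
  obtain \<omega> where \<omega>: "\<omega> \<in> C" using C'(2) by blast
  obtain B where B: "0 < B" "\<And>y. support_fun C y \<le> B * norm y"
    using support_fun_le_norm[OF C'] by blast
  obtain L where L: "0 < L" "\<And>y a s. tnorm g y a = 1 \<Longrightarrow> 0 \<le> s \<Longrightarrow>
      norm (mderiv eucl eucl (F \<circ> R y) (s *\<^sub>R a) a - mderiv eucl eucl (F \<circ> R y) 0 a) \<le> L * s"
    using i by blast
  have seq: "v k \<noteq> 0" "0 < t k" "x (Suc k) = R (x k) (t k *\<^sub>R d k)" for k
    using sequences by (auto simp: rcg_sequences_def v_def)
  have armijo: "cone_le K (F (x (Suc k))) (F (x k) + (c1 * t k * J k) *\<^sub>R e)"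
    and curv: "\<bar>psi A C F R (x k) (d k) (t k)\<bar> \<le> c2 * \<bar>psi A C F R (x k) (d k) 0\<bar>" for k
    using wolfe by (auto simp: strong_wolfe_def J_def seq(3))
  have c2: "0 < c2" using c by simp
  have tpos: "0 < tnorm g p a" if "a \<noteq> 0" for p a
    using manifold(2) that by (auto simp: riemannian_metric_def tnorm_def)
  have descent: "J k \<le> - (1 - c2) * (tnorm g (x k) (v k))\<^sup>2" for k
    unfolding J_def v_def
    by (rule rcg_sufficient_descent[OF manifold F R C' c2 c(3) sequences beta curv])
  have J: "J k < 0" for k
  proof -
    have "0 < (1 - c2) * (tnorm g (x k) (v k))\<^sup>2" using c tpos[OF seq(1)[of k], of "x k"] by simp
    with descent[of k] show ?thesis by (simp add: algebra_simps)
  qed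
  have d: "d k \<noteq> 0" for k
  proof
    assume "d k = 0"
    then have "J k = 0"
      using linear_0[OF linear_mderiv[OF manifold(1) F]] support_fun_zero[OF C'(2)]
      by (simp add: J_def)
    with J[of k] show False by simp
  qed
  then have n: "0 < n k" for k by (simp add: n_def tpos)

  \<comment> \<open>The curvature condition forces \<open>psi\<close> to rise by at least
    \<open>(1 - c2) * - J k\<close>, and \<open>psi_diff_le\<close> limits the rise: a lower bound
    on \<open>t k\<close> in division-free form.\<close>
  have step: "(1 - c2) * - J k \<le> B * L * t k * (n k)\<^sup>2" for k
  proof -
    have "psi A C F R (x k) (d k) (t k) - J k \<le> B * L * t k * (n k)\<^sup>2"
      unfolding n_def J_def psi_zero[OF R, symmetric]
      by (rule psi_diff_le[OF manifold F R C' B L(2) d less_imp_le[OF seq(2)]])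
    then show ?thesis
      using curv[of k] J[of k] by (simp add: psi_zero[OF R] J_def algebra_simps)
  qed

  have K_add: "a + b \<in> K" if "a \<in> K" "b \<in> K" for a b
    using K(2,3) that convex_cone by metis
  have K_scale: "r *\<^sub>R a \<in> K" if "a \<in> K" "0 \<le> r" for r a
    using K(3) that by (simp add: cone_def)
  have mono: "cone_le K (F (x (Suc k))) (F (x k))" for k
  proof -
    have "(c1 * t k * - J k) *\<^sub>R e \<in> K"
      using c(1) seq(2)[of k] J[of k]
      by (intro K_scale e(1)) (simp add: mult_nonneg_nonpos less_imp_le)
    from K_add[OF armijo[of k, unfolded cone_le_def] this]
    show ?thesis by (simp add: cone_le_def)
  qed
  \<comment> \<open>Membership in the level set makes the values \<open>F (x k)\<close> an
    admissible sequence for assumption \<open>ii\<close>, which supplies a lower bound.\<close>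
  have "x k \<in> \<L>" for k
  proof (induction k)
    case 0
    show ?case using K_scale[OF e(1), of 0] by (simp add: level cone_le_def)
  next
    case (Suc k)
    with K_add[of "F (x k) - F (x (Suc k))" "F (x 0) - F (x k)"] mono[of k]
    show ?case by (simp add: level cone_le_def)
  qed
  with ii[rule_format, of "\<lambda>k. F (x k)"] mono obtain G where G: "\<And>k. cone_le K G (F (x k))"
    by blast
  have \<omega>K: "\<omega> \<bullet> a \<le> \<omega> \<bullet> b" if "cone_le K a b" for a b
  proof -
    have "\<omega> \<in> dual_cone K" using C(2) \<omega> by blast
    then have "0 \<le> \<omega> \<bullet> (b - a)" using that by (simp add: cone_le_def dual_cone_def)
    then show ?thesis by (simp add: inner_diff_right)
  qed
  have \<omega>e: "0 < \<omega> \<bullet> e" using e(2) \<omega> by blast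
  \<comment> \<open>Scalarized by \<open>\<omega>\<close>, the Armijo inequalities
    telescope.\<close>
  have sum: "c1 * (\<omega> \<bullet> e) * (\<Sum>k<N. t k * - J k) \<le> \<omega> \<bullet> F (x 0) - \<omega> \<bullet> F (x N)" for N
  proof (induction N)
    case (Suc N)
    then show ?case
      using \<omega>K[OF armijo[of N]] by (simp add: inner_add_right algebra_simps)
  qed simp
  define S where "S = (\<omega> \<bullet> F (x 0) - \<omega> \<bullet> G) / (c1 * (\<omega> \<bullet> e))"
  have bounded: "(\<Sum>k<N. t k * - J k) \<le> S" for N
    using sum[of N] \<omega>K[OF G[of N]] c(1) \<omega>e by (simp add: S_def field_simps)

  have lim_pos: "0 \<le> liminf (\<lambda>k. ereal (tnorm g (x k) (v k)))"
    by (rule Liminf_bounded) (auto intro!: always_eventually less_imp_le tpos seq)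
  have "liminf (\<lambda>k. ereal (tnorm g (x k) (v k))) \<le> 0"
  proof (rule ccontr)
    assume "\<not> ?thesis"
    then obtain \<gamma> where \<gamma>: "0 < \<gamma>" "ereal \<gamma> < liminf (\<lambda>k. ereal (tnorm g (x k) (v k)))"
      using ereal_dense2[of 0] by (metis ereal_less(2) not_le)
    then obtain M where M: "\<And>k. M \<le> k \<Longrightarrow> \<gamma> < tnorm g (x k) (v k)"
      using less_LiminfD[OF \<gamma>(2)] by (auto simp: eventually_sequentially)
    \<comment> \<open>The constant obtained by multiplying \<open>step\<close> by
      \<open>- J k\<close> and inserting \<open>(1 - c2) * \<gamma>\<^sup>2 \<le> - J k\<close>,
      valid from index \<open>M\<close> on.\<close>
    define \<delta> where "\<delta> = (1 - c2) * ((1 - c2) * \<gamma>\<^sup>2)\<^sup>2 / (B * L)"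
    have \<delta>: "0 < \<delta>" using c B(1) L(1) \<gamma>(1) by (simp add: \<delta>_def)
    have term_le: "\<delta> * (1 / (n k)\<^sup>2) \<le> t k * - J k" if "M \<le> k" for k
    proof -
      have "\<gamma>\<^sup>2 \<le> (tnorm g (x k) (v k))\<^sup>2" using M[OF that] \<gamma>(1) by (intro power_mono) auto
      then have "(1 - c2) * \<gamma>\<^sup>2 \<le> (1 - c2) * (tnorm g (x k) (v k))\<^sup>2"
        using c by (intro mult_left_mono) auto
      then have "(1 - c2) * \<gamma>\<^sup>2 \<le> - J k"
        using descent[of k] by (simp add: algebra_simps)
      then have "((1 - c2) * \<gamma>\<^sup>2)\<^sup>2 \<le> (- J k)\<^sup>2" using c by (intro power_mono) auto
      then have "(1 - c2) * ((1 - c2) * \<gamma>\<^sup>2)\<^sup>2 \<le> (1 - c2) * (- J k)\<^sup>2"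
        using c by (intro mult_left_mono) auto
      also have "\<dots> = ((1 - c2) * - J k) * - J k" by (simp add: power2_eq_square)
      also have "\<dots> \<le> (B * L * t k * (n k)\<^sup>2) * - J k"
        using J[of k] by (intro mult_right_mono step) simp
      finally show ?thesis
        using B(1) L(1) n[of k] by (simp add: \<delta>_def divide_simps mult_ac)
    qed
    have tail: "\<delta> * (\<Sum>k<N. 1 / (n k)\<^sup>2) \<le> \<delta> * (\<Sum>k<M. 1 / (n k)\<^sup>2) + S" for N
    proof -
      \<comment> \<open>Enlarging the range to \<open>M + N\<close> allows a split at
        \<open>M\<close> without comparing \<open>N\<close> and \<open>M\<close>.\<close>
      have "(\<Sum>k<N. 1 / (n k)\<^sup>2) \<le> (\<Sum>k<M + N. 1 / (n k)\<^sup>2)"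
        by (intro sum_mono2) auto
      also have "\<dots> = (\<Sum>k<M. 1 / (n k)\<^sup>2) + (\<Sum>k=M..<M+N. 1 / (n k)\<^sup>2)"
        by (simp add: sum.atLeastLessThan_concat lessThan_atLeast0)
      finally have "\<delta> * (\<Sum>k<N. 1 / (n k)\<^sup>2)
          \<le> \<delta> * ((\<Sum>k<M. 1 / (n k)\<^sup>2) + (\<Sum>k=M..<M+N. 1 / (n k)\<^sup>2))"
        using \<delta> by (intro mult_left_mono) auto
      also have "\<dots> = \<delta> * (\<Sum>k<M. 1 / (n k)\<^sup>2) + (\<Sum>k=M..<M+N. \<delta> * (1 / (n k)\<^sup>2))"
        by (simp only: distrib_left sum_distrib_left)
      also have "(\<Sum>k=M..<M+N. \<delta> * (1 / (n k)\<^sup>2)) \<le> (\<Sum>k=M..<M+N. t k * - J k)"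
        by (intro sum_mono term_le) simp
      also have "\<dots> \<le> (\<Sum>k<M+N. t k * - J k)"
        using seq(2) J by (intro sum_mono2) (auto simp: less_imp_le mult_nonneg_nonpos)
      also have "\<dots> \<le> S" by (rule bounded)
      finally show ?thesis by simp
    qed
    \<comment> \<open>The threshold is the right-hand side of \<open>tail\<close> divided by
      \<open>\<delta>\<close>.\<close>
    have "\<forall>\<^sub>F N in sequentially. (\<Sum>k<M. 1 / (n k)\<^sup>2) + S / \<delta> < (\<Sum>k<N. 1 / (n k)\<^sup>2)"
      using iv unfolding n_def filterlim_at_top_dense by blast
    then obtain N where "(\<Sum>k<M. 1 / (n k)\<^sup>2) + S / \<delta> < (\<Sum>k<N. 1 / (n k)\<^sup>2)"
      by (auto simp: eventually_sequentially)
    then have "\<delta> * ((\<Sum>k<M. 1 / (n k)\<^sup>2) + S / \<delta>) < \<delta> * (\<Sum>k<N. 1 / (n k)\<^sup>2)"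
      using \<delta> by (rule mult_strict_left_mono)
    with tail[of N] \<delta> show False by (simp add: distrib_left)
  qed
  with lim_pos show ?thesis by (simp add: v_def)
qed

end
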